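(* Suppose $0<\rho_1<\rho_2$, and let $\pi_i$ denote the optimal investment strategy $\pi^*$ when $\rho=\rho_i$ for $i=1,2$ (all other parameters being the same). Then $\pi_1(w)=\pi_2(w)$ for $0<w<c/r$, and $\pi_1(w)<\pi_2(w)$ for $-L<w<0$.
   Context: Parameters: $r>0$, $\mu>r$, $\sigma>0$, $c>0$, $\lambda>0$, $\rho>0$, $L>0$, and $\delta=\frac12\left(\frac{\mu-r}\sigma\right)^2$. An individual with wealth $dW^\pi_t=(rW^\pi_t+(\mu-r)\pi_t-c)\,dt+\sigma\pi_t\,dB_t$ ($B$ a standard Brownian motion), and with an independent exponential time of death of rate $\lambda$, chooses the amount $\pi_t$ invested in the risky asset. $\pi^*$ denotes the optimal feedback strategy when minimizing the probability of lifetime exponential Parisian ruin, i.e. that, before death, an excursion of wealth below $0$ lasts longer than an independent exponential clock of rate $\rho$ (reset at each excursion), where the game is stopped with payoff $\rho/(\lambda+\rho)$ if wealth reaches $-L$ first. Explicitly, let $q=\frac1{2r}\left[(r+\lambda+\delta)+\sqrt{(r+\lambda+\delta)^2-4r\lambda}\right]>1$, and let $B_3>1$ and $B_4<0$ be given by $$\frac1{2\delta}\left[(r-\lambda-\rho+\delta)\pm\sqrt{(r-\lambda-\rho+\delta)^2+4\delta(\lambda+\rho)}\right]$$ (sign $+$ for $B_3$, $-$ for $B_4$). Then $$\pi^*(w)=\begin{cases}\dfrac{\mu-r}{\sigma^2}\left(\dfrac cr+L\right)\dfrac{(B_3-1)(1-B_4)}{B_3-B_4}\left[B_3z^{B_3-1}-B_4z^{B_4-1}\right],&-L<w<0,\\[2ex]\dfrac{\mu-r}{\sigma^2}\,\dfrac{c/r-w}{q-1},&0<w\le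 c/r,\end{cases}$$ where, for $-L<w<0$, $z=z(w)$ is the unique solution in $]y_{0L},1[$ of $$\frac cr-w=\left(\frac cr+L\right)\left[\frac{B_3(1-B_4)}{B_3-B_4}z^{B_3-1}+\frac{B_4(B_3-1)}{B_3-B_4}z^{B_4-1}\right],$$ and $y_{0L}\in\,]0,1[$ is the unique solution in $]0,1[$ of the same equation with $w=0$. *)

theory Defs
  imports Complex_Main
begin

text \<open>
  Lifetime exponential Parisian ruin. Wealth follows
  \<open>dW = (r W + (\<mu> - r) \<pi> - c) dt + \<sigma> \<pi> dB\<close>, the death rate is \<open>lam\<close>, the rate of the Parisian
  clock (reset at each excursion below 0) is \<open>\<rho>\<close>, and the game is stopped with payoff
  \<open>\<rho> / (lam + \<rho>)\<close> if wealth reaches \<open>-L\<close> before ruin or death. The optimal feedback strategy is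
  represented by its explicit formula; the underlying stochastic control problem is not formalized.
\<close>

definition delta :: "real \<Rightarrow> real \<Rightarrow> real \<Rightarrow> real" where
  "delta r \<mu> \<sigma> = 1 / 2 * ((\<mu> - r) / \<sigma>)\<^sup>2"

definition q_exp :: "real \<Rightarrow> real \<Rightarrow> real \<Rightarrow> real \<Rightarrow> real" where
  "q_exp r \<mu> \<sigma> lam =
     (let d = delta r \<mu> \<sigma>
      in 1 / (2 * r) * ((r + lam + d) + sqrt ((r + lam + d)\<^sup>2 - 4 * r * lam)))"

definition B3 :: "real \<Rightarrow> real \<Rightarrow> real \<Rightarrow> real \<Rightarrow> real \<Rightarrow> real" where
  "B3 r \<mu> \<sigma> lam \<rho> =
     (let d = delta r \<mu> \<sigma>
      in 1 / (2 * d) * ((r - lam - \<rho> + d) + sqrt ((r - lam - \<rho> + d)\<^sup>2 + 4 * d * (lam + \<rho>))))"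

definition B4 :: "real \<Rightarrow> real \<Rightarrow> real \<Rightarrow> real \<Rightarrow> real \<Rightarrow> real" where
  "B4 r \<mu> \<sigma> lam \<rho> =
     (let d = delta r \<mu> \<sigma>
      in 1 / (2 * d) * ((r - lam - \<rho> + d) - sqrt ((r - lam - \<rho> + d)\<^sup>2 + 4 * d * (lam + \<rho>))))"

definition z_equation ::
  "real \<Rightarrow> real \<Rightarrow> real \<Rightarrow> real \<Rightarrow> real \<Rightarrow> real \<Rightarrow> real \<Rightarrow> real \<Rightarrow> real \<Rightarrow> bool" where
  "z_equation r \<mu> \<sigma> c lam L \<rho> w z \<longleftrightarrow>
     (let b3 = B3 r \<mu> \<sigma> lam \<rho>; b4 = B4 r \<mu> \<sigma> lam \<rho>
      in c / r - w =
           (c / r + L) * (b3 * (1 - b4) / (b3 - b4) * z powr (b3 - 1)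
                        + b4 * (b3 - 1) / (b3 - b4) * z powr (b4 - 1)))"

definition y0L ::
  "real \<Rightarrow> real \<Rightarrow> real \<Rightarrow> real \<Rightarrow> real \<Rightarrow> real \<Rightarrow> real \<Rightarrow> real" where
  "y0L r \<mu> \<sigma> c lam L \<rho> =
     (THE y. 0 < y \<and> y < 1 \<and> z_equation r \<mu> \<sigma> c lam L \<rho> 0 y)"

definition z_of_w ::
  "real \<Rightarrow> real \<Rightarrow> real \<Rightarrow> real \<Rightarrow> real \<Rightarrow> real \<Rightarrow> real \<Rightarrow> real \<Rightarrow> real" where
  "z_of_w r \<mu> \<sigma> c lam L \<rho> w =
     (THE z. y0L r \<mu> \<sigma> c lam L \<rho> < z \<and> z < 1 \<and> z_equation r \<mu> \<sigma> c lam L \<rho> w z)"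

text \<open>The strategy is left unspecified at \<open>w = 0\<close> and outside \<open>-L < w \<le> c / r\<close>.\<close>

definition opt_strategy ::
  "real \<Rightarrow> real \<Rightarrow> real \<Rightarrow> real \<Rightarrow> real \<Rightarrow> real \<Rightarrow> real \<Rightarrow> real \<Rightarrow> real" where
  "opt_strategy r \<mu> \<sigma> c lam L \<rho> w =
     (if - L < w \<and> w < 0 then
        (let b3 = B3 r \<mu> \<sigma> lam \<rho>; b4 = B4 r \<mu> \<sigma> lam \<rho>; z = z_of_w r \<mu> \<sigma> c lam L \<rho> w
         in (\<mu> - r) / \<sigma>\<^sup>2 * (c / r + L) * ((b3 - 1) * (1 - b4) / (b3 - b4))
              * (b3 * z powr (b3 - 1) - b4 * z powr (b4 - 1)))
      else if 0 < w \<and> w \<le> c / r then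
        (\<mu> - r) / \<sigma>\<^sup>2 * ((c / r - w) / (q_exp r \<mu> \<sigma> lam - 1))
      else undefined)"

end

theory Submission
  imports Defs
begin

text \<open>
  Fix \<open>\<rho>\<close>, put \<open>a = B3 - 1 > 0\<close>, \<open>b = 1 - B4 > 1\<close>, and parametrize the region below ruin level by
  \<open>t = ln z < 0\<close>. With \<open>X = (c/r - w) / (c/r + L)\<close>, the distance from the safe level scaled so that
  \<open>X = 1\<close> at \<open>w = -L\<close>, the equation for \<open>z\<close> reads \<open>X = gap a b t\<close>, a combination of
  \<open>exp (a t)\<close> and \<open>exp (- b t)\<close>. The invested amount is, up to a positive factor free of \<open>\<rho>\<close>, the
  derivative \<open>P = X'(t)\<close>. Hence \<open>(X, P)\<close> runs along the trajectory of
  \<open>X' = P\<close>, \<open>P' = (a - b) P + a b X\<close>, which ends at \<open>(1, a b)\<close> when \<open>t = 0\<close>.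

  Vieta's formulas give \<open>a b = r / \<delta>\<close> and \<open>a - b = (r - lam - \<rho>) / \<delta> - 1\<close>. So \<open>\<rho>\<close> moves neither the end
  point nor the coefficient of \<open>X\<close>; it only lowers the coefficient of \<open>P\<close>. In the \<open>(X, P)\<close> plane a
  larger \<open>\<rho>\<close> therefore gives a smaller slope \<open>dP/dX = (a - b) + a b X / P\<close>, and going back from the
  common end point \<open>X = 1\<close> the trajectory with the larger \<open>\<rho>\<close> lies above.

  The comparison is carried out with the first integral
  \<open>F(X, P) = b ln (P + b X) + a ln (P - a X)\<close> of the system with the larger \<open>\<rho>\<close>. It is constant on its
  own trajectory, strictly increasing along the trajectory of the smaller \<open>\<rho>\<close>, and both trajectories
  end at the same point; so at equal \<open>X < 1\<close> the smaller \<open>\<rho>\<close> gives the smaller value of \<open>F\<close>, hence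
  the smaller \<open>P\<close>, because \<open>F\<close> increases with \<open>P\<close>. This is \<open>alloc_less_alloc\<close>.
  Above \<open>0\<close> the strategy does not involve \<open>\<rho>\<close> at all.
\<close>

section \<open>The trajectory in logarithmic coordinates\<close>

definition gap :: "real \<Rightarrow> real \<Rightarrow> real \<Rightarrow> real" where
  "gap a b t = (b * (a + 1) * exp (a * t) - a * (b - 1) * exp (- b * t)) / (a + b)"

definition alloc :: "real \<Rightarrow> real \<Rightarrow> real \<Rightarrow> real" where
  "alloc a b t = a * b * ((a + 1) * exp (a * t) + (b - 1) * exp (- b * t)) / (a + b)"

lemma has_real_derivative_gap:
  "(gap a b has_real_derivative alloc a b t) (at t)"
  unfolding gap_def alloc_def
  by (rule DERIV_cdivide) (auto intro!: derivative_eq_intros simp: algebra_simps)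

lemma has_real_derivative_alloc:
  assumes "a > 0" "b > 0"
  shows "(alloc a b has_real_derivative ((a - b) * alloc a b t + a * b * gap a b t)) (at t)"
proof -
  have "a + b \<noteq> 0" using assms by simp
  hence "(a - b) * alloc a b t + a * b * gap a b t
      = a * b * ((a + 1) * (a * exp (a * t)) + (b - 1) * (- b * exp (- b * t))) / (a + b)"
    unfolding gap_def alloc_def by (simp add: divide_simps) (simp add: algebra_simps)
  moreover have "(alloc a b has_real_derivative
      a * b * ((a + 1) * (a * exp (a * t)) + (b - 1) * (- b * exp (- b * t))) / (a + b)) (at t)"
    unfolding alloc_def
    by (rule DERIV_cdivide) (auto intro!: derivative_eq_intros simp: algebra_simps)
  ultimately show ?thesis by simp
qed

lemma alloc_pos: "a > 0 \<Longrightarrow> b > 1 \<Longrightarrow> alloc a b t > 0"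
  unfolding alloc_def by (intro divide_pos_pos mult_pos_pos add_pos_pos) auto

text \<open>
  The coordinates along the two eigendirections of the linear system: each of them is a single
  exponential, so both logarithms in the first integral are affine in \<open>t\<close>.
\<close>

lemma alloc_add_gap:
  assumes "a > 0" "b > 0"
  shows "alloc a b t + b * gap a b t = b * (a + 1) * exp (a * t)"
  using assms unfolding gap_def alloc_def
  by (simp add: divide_simps add_pos_pos less_imp_neq[symmetric]) (simp add: algebra_simps)

lemma alloc_diff_gap:
  assumes "a > 0" "b > 0"
  shows "alloc a b t - a * gap a b t = a * (b - 1) * exp (- b * t)"
  using assms unfolding gap_def alloc_def
  by (simp add: divide_simps add_pos_pos less_imp_neq[symmetric]) (simp add: algebra_simps)

lemma gap_0: "a > 0 \<Longrightarrow> b > 0 \<Longrightarrow> gap a b 0 = 1"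
  unfolding gap_def by (simp add: field_simps)

lemma alloc_0: "a > 0 \<Longrightarrow> b > 0 \<Longrightarrow> alloc a b 0 = a * b"
  unfolding alloc_def by (simp add: field_simps)

lemma strict_mono_gap:
  assumes "a > 0" "b > 1"
  shows "strict_mono (gap a b)"
proof (rule strict_monoI)
  fix x y :: real
  assume "x < y"
  then show "gap a b x < gap a b y"
    by (rule DERIV_pos_imp_increasing) (use has_real_derivative_gap alloc_pos[OF assms] in blast)
qed

lemma gap_attains:
  assumes ab: "a > 0" "b > 1" and x: "0 < x" "x < 1"
  obtains t where "t < 0" "gap a b t = x"
proof -
  \<comment> \<open>The time at which the two exponential terms of \<open>gap\<close> cancel.\<close>
  define t0 where "t0 = ln (a * (b - 1) / (b * (a + 1))) / (a + b)"
  have "exp ((a + b) * t0) = a * (b - 1) / (b * (a + 1))"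
    using ab by (simp add: t0_def)
  moreover have "exp (a * t0) = exp ((a + b) * t0) * exp (- b * t0)"
    by (simp add: exp_add[symmetric] algebra_simps)
  ultimately have "gap a b t0 = 0"
    using ab by (simp add: gap_def divide_simps) (simp add: mult_ac)
  have "t0 < 0"
  proof (rule ccontr)
    assume "\<not> t0 < 0"
    hence "gap a b 0 \<le> gap a b t0"
      using strict_mono_less_eq[OF strict_mono_gap[OF ab]] by simp
    thus False using gap_0[of a b] \<open>gap a b t0 = 0\<close> ab by simp
  qed
  have "continuous_on {t0..0} (gap a b)"
    using has_real_derivative_gap DERIV_isCont by (blast intro: continuous_at_imp_continuous_on)
  then obtain t where t: "t0 \<le> t" "t \<le> 0" "gap a b t = x"
    using IVT'[of "gap a b" t0 x 0] \<open>gap a b t0 = 0\<close> gap_0[of a b] ab x \<open>t0 < 0\<close> by auto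
  moreover have "t \<noteq> 0" using t gap_0[of a b] ab x by auto
  ultimately show ?thesis by (intro that[of t]) auto
qed

section \<open>Comparison of two trajectories\<close>

definition first_integral :: "real \<Rightarrow> real \<Rightarrow> real \<Rightarrow> real \<Rightarrow> real" where
  "first_integral a b x p = b * ln (p + b * x) + a * ln (p - a * x)"

lemma first_integral_own_trajectory:
  assumes "a > 0" "b > 1"
  shows "first_integral a b (gap a b t) (alloc a b t) = first_integral a b 1 (a * b)"
proof -
  have "a * b + b * 1 = b * (a + 1)" "a * b - a * 1 = a * (b - 1)"
    by (simp_all add: algebra_simps)
  moreover have "ln (b * (a + 1) * exp (a * t)) = ln (b * (a + 1)) + a * t"
    using assms by (subst ln_mult) auto
  moreover have "ln (a * (b - 1) * exp (- b * t)) = ln (a * (b - 1)) - b * t"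
    using assms by (subst ln_mult) auto
  ultimately show ?thesis
    unfolding first_integral_def using assms
    by (simp only: alloc_add_gap alloc_diff_gap less_trans[OF zero_less_one])
      (simp add: right_diff_distrib distrib_left mult_ac)
qed

lemma first_integral_mono:
  assumes "a > 0" "b > 0" "x \<ge> 0" "p - a * x > 0" "p \<le> p'"
  shows "first_integral a b x p \<le> first_integral a b x p'"
proof -
  have "p > 0" using assms by (smt (verit) mult_nonneg_nonneg)
  hence "p + b * x > 0" using assms by (simp add: add_pos_nonneg)
  thus ?thesis unfolding first_integral_def using assms
    by (intro add_mono mult_left_mono) auto
qed

text \<open>
  Along the trajectory of \<open>(a, b)\<close> the eigencoordinates of \<open>(a', b')\<close> obey their own linear equations
  with an extra term \<open>e P\<close>, where \<open>e = (a - b) - (a' - b') > 0\<close>. The contributions of the linear parts to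
  the derivative of the first integral are \<open>b' a'\<close> and \<open>- a' b'\<close> and cancel, so only the positive
  contribution of \<open>e P\<close> is left.
\<close>

lemma first_integral_increasing:
  assumes ab: "a > 0" "b > 1" and ab': "a' > 0" "b' > 1"
    and prod: "a * b = a' * b'" and diff: "a' - b' < a - b"
    and dom: "\<And>s. t \<le> s \<Longrightarrow> s \<le> 0 \<Longrightarrow>
      alloc a b s + b' * gap a b s > 0 \<and> alloc a b s - a' * gap a b s > 0"
    and "t < 0"
  shows "first_integral a' b' (gap a b t) (alloc a b t)
       < first_integral a' b' (gap a b 0) (alloc a b 0)"
proof (rule DERIV_pos_imp_increasing[OF \<open>t < 0\<close>])
  fix s assume s: "t \<le> s" "s \<le> 0"
  define X P where "X = gap a b s" and "P = alloc a b s"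
  define e where "e = (a - b) - (a' - b')"
  have pos: "P + b' * X > 0" "P - a' * X > 0" "P > 0" "e > 0"
    using dom[OF s] alloc_pos[OF ab] diff by (auto simp: X_def P_def e_def)
  have "b > 0" using ab by simp
  note dX = has_real_derivative_gap[of a b s, folded P_def]
  note dP = has_real_derivative_alloc[OF \<open>a > 0\<close> \<open>b > 0\<close>, of s, folded P_def X_def]
  let ?P' = "(a - b) * P + a * b * X"
  have lin: "?P' + b' * P = e * P + a' * (P + b' * X)" "?P' - a' * P = e * P - b' * (P - a' * X)"
    using prod by (simp_all add: e_def algebra_simps)
  have "((\<lambda>s. first_integral a' b' (gap a b s) (alloc a b s)) has_real_derivative
      b' * ((?P' + b' * P) / (P + b' * X)) + a' * ((?P' - a' * P) / (P - a' * X))) (at s)"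
    unfolding first_integral_def using pos
    by (auto intro!: derivative_eq_intros dX dP simp: X_def[symmetric] P_def[symmetric] mult_ac)
  moreover have "b' * ((?P' + b' * P) / (P + b' * X)) + a' * ((?P' - a' * P) / (P - a' * X))
      = e * P * (b' / (P + b' * X) + a' / (P - a' * X))"
  proof -
    have "(e * P + a' * u) / u = e * P / u + a'" "(e * P - b' * v) / v = e * P / v - b'"
      if "u > 0" "v > 0" for u v
      using that by (simp_all add: add_divide_distrib diff_divide_distrib)
    note split = this[OF pos(1,2)]
    show ?thesis unfolding lin split by (simp add: algebra_simps)
  qed
  moreover have "e * P * (b' / (P + b' * X) + a' / (P - a' * X)) > 0"
    using divide_pos_pos[OF _ pos(1), of b'] divide_pos_pos[OF _ pos(2), of a'] pos(3,4) ab'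
    by (intro mult_pos_pos add_pos_pos) auto
  ultimately show "\<exists>D. ((\<lambda>s. first_integral a' b' (gap a b s) (alloc a b s)) has_real_derivative D)
      (at s) \<and> 0 < D"
    by metis
qed

text \<open>
  The first integral of \<open>(a', b')\<close> is usable along the whole trajectory of \<open>(a, b)\<close> because the
  hypotheses force \<open>a' < a\<close>, so that \<open>P - a' X \<ge> P - a X > 0\<close> as long as \<open>X > 0\<close>.
\<close>

lemma alloc_less_alloc:
  assumes ab: "a > 0" "b > 1" and ab': "a' > 0" "b' > 1"
    and prod: "a * b = a' * b'" and diff: "a' - b' < a - b"
    and t: "t < 0" and pos: "gap a b t > 0" and eq: "gap a b t = gap a' b' t'"
  shows "alloc a b t < alloc a' b' t'"
proof -
  have b: "b > 0" "b' > 0" using ab ab' by auto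
  have "a' < a"
  proof (rule ccontr)
    assume "\<not> a' < a"
    hence "b < b'" using diff by simp
    hence "a * b < a' * b'" using \<open>\<not> a' < a\<close> ab b by (intro mult_le_less_imp_less) auto
    thus False using prod by simp
  qed
  have dom: "alloc a b s + b' * gap a b s > 0 \<and> alloc a b s - a' * gap a b s > 0"
    if "t \<le> s" for s
  proof -
    have X: "gap a b s > 0"
      using strict_mono_less_eq[OF strict_mono_gap[OF ab], of t s] that pos by simp
    have "a * gap a b s < alloc a b s"
      using alloc_diff_gap[OF ab(1) b(1), of s] ab by (smt (verit) exp_gt_zero mult_pos_pos)
    moreover have "a' * gap a b s < a * gap a b s" using X \<open>a' < a\<close> by simp
    ultimately have "a' * gap a b s < alloc a b s" by (rule less_trans[rotated])
    thus ?thesis using X alloc_pos[OF ab, of s] b by (simp add: add_pos_pos)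
  qed
  have "first_integral a' b' (gap a b t) (alloc a b t)
      < first_integral a' b' (gap a b 0) (alloc a b 0)"
    by (rule first_integral_increasing[OF ab ab' prod diff _ t]) (use dom in blast)
  also have "\<dots> = first_integral a' b' 1 (a' * b')"
    using ab b prod by (simp add: gap_0 alloc_0)
  also have "\<dots> = first_integral a' b' (gap a b t) (alloc a' b' t')"
    using first_integral_own_trajectory[OF ab', of t'] eq by simp
  finally have less: "first_integral a' b' (gap a b t) (alloc a b t)
      < first_integral a' b' (gap a b t) (alloc a' b' t')" .
  show ?thesis
  proof (rule ccontr)
    assume "\<not> alloc a b t < alloc a' b' t'"
    moreover have "alloc a' b' t' - a' * gap a b t > 0"
      using alloc_diff_gap[OF ab'(1) b(2), of t'] ab' eq by simp
    ultimately show False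
      using first_integral_mono[of a' b' "gap a b t" "alloc a' b' t'" "alloc a b t"]
        ab' b pos less by simp
  qed
qed

section \<open>The strategy on the trajectory\<close>

lemma delta_pos: "\<mu> > r \<Longrightarrow> \<sigma> > 0 \<Longrightarrow> delta r \<mu> \<sigma> > 0"
  by (simp add: delta_def)

text \<open>
  \<open>B3\<close> and \<open>B4\<close> are the roots of \<open>\<delta> B\<^sup>2 - (r - lam - \<rho> + \<delta>) B - (lam + \<rho>)\<close>, which is negative at \<open>B = 0\<close> and
  takes the value \<open>- r\<close> at \<open>B = 1\<close>; so the roots enclose \<open>[0, 1]\<close>.
\<close>

lemma B3_B4:
  assumes "r > 0" "\<mu> > r" "\<sigma> > 0" "lam > 0" "\<rho> > 0"
  defines "a \<equiv> B3 r \<mu> \<sigma> lam \<rho> - 1" and "b \<equiv> 1 - B4 r \<mu> \<sigma> lam \<rho>"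
    and "d \<equiv> delta r \<mu> \<sigma>"
  shows "a > 0" "b > 1" "a * b = r / d" "a - b = (r - lam - \<rho>) / d - 1"
proof -
  define h where "h = r - lam - \<rho> + d"
  define S where "S = sqrt (h\<^sup>2 + 4 * d * (lam + \<rho>))"
  have d: "d > 0" using assms delta_pos by simp
  have m: "d * (lam + \<rho>) > 0" using d assms by simp
  have S2: "S\<^sup>2 = h\<^sup>2 + 4 * d * (lam + \<rho>)"
    unfolding S_def using m by simp
  have "S \<ge> 0" unfolding S_def using m by simp
  have B: "B3 r \<mu> \<sigma> lam \<rho> = (h + S) / (2 * d)" "B4 r \<mu> \<sigma> lam \<rho> = (h - S) / (2 * d)"
    unfolding B3_def B4_def Let_def h_def S_def d_def by simp_all
  have "h < S" using S2 m \<open>S \<ge> 0\<close>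
    by (intro power2_less_imp_less[of h S]) simp_all
  thus b: "b > 1" using d by (simp add: b_def B divide_less_0_iff)
  have "a * b = ((h + S - 2 * d) * (2 * d - h + S)) / (4 * d\<^sup>2)"
    unfolding a_def b_def B using d by (simp add: field_simps power2_eq_square)
  also have "(h + S - 2 * d) * (2 * d - h + S) = 4 * d * r"
    using S2 by (simp add: h_def algebra_simps power2_eq_square)
  also have "4 * d * r / (4 * d\<^sup>2) = r / d"
    using d by (simp add: power2_eq_square)
  finally show ab: "a * b = r / d" .
  show "a > 0" using ab b d assms(1) by (metis divide_pos_pos less_trans zero_less_mult_pos2 zero_less_one)
  show "a - b = (r - lam - \<rho>) / d - 1"
    unfolding a_def b_def B using d by (simp add: h_def field_simps)
qed

lemma z_equation_iff_gap:
  assumes "z > 0"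
  shows "z_equation r \<mu> \<sigma> c lam L \<rho> w z \<longleftrightarrow>
    c / r - w = (c / r + L) * gap (B3 r \<mu> \<sigma> lam \<rho> - 1) (1 - B4 r \<mu> \<sigma> lam \<rho>) (ln z)"
  unfolding z_equation_def gap_def Let_def using assms
  by (simp add: powr_def algebra_simps add_divide_distrib diff_divide_distrib)

text \<open>
  Both definite descriptions behind the strategy denote genuine solutions because \<open>gap\<close> increases
  strictly and takes every value in \<open>]0, 1[\<close> at a negative time. The solution exceeds \<open>y0L\<close>
  since the scaled distance at \<open>w < 0\<close> exceeds the one at \<open>0\<close>. The time \<open>t\<close> obtained is \<open>ln z\<close>.
\<close>

lemma opt_strategy_below_zero:
  assumes "r > 0" "\<mu> > r" "\<sigma> > 0" "c > 0" "lam > 0" "L > 0" "\<rho> > 0" "- L < w" "w < 0"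
  defines "a \<equiv> B3 r \<mu> \<sigma> lam \<rho> - 1" and "b \<equiv> 1 - B4 r \<mu> \<sigma> lam \<rho>"
  obtains t where "t < 0" "gap a b t = (c / r - w) / (c / r + L)"
    "opt_strategy r \<mu> \<sigma> c lam L \<rho> w = (\<mu> - r) / \<sigma>\<^sup>2 * (c / r + L) * alloc a b t"
proof -
  have ab: "a > 0" "b > 1" using B3_B4[OF assms(1,2,3,5,7)] by (auto simp: a_def b_def)
  note mono = strict_mono_gap[OF ab]
  have cr: "c / r > 0" "c / r + L > 0" using assms by (auto intro: add_pos_pos)
  define x where "x v = (c / r - v) / (c / r + L)" for v
  have x: "0 < x v" "x v < 1" if "- L < v" "v \<le> 0" for v
    using that cr unfolding x_def by (auto intro: divide_pos_pos)
  have zeq: "z_equation r \<mu> \<sigma> c lam L \<rho> v z \<longleftrightarrow> gap a b (ln z) = x v" if "z > 0" for v z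
    unfolding z_equation_iff_gap[OF that] a_def b_def x_def
    using cr by (auto simp: field_simps)
  obtain t0 where t0: "t0 < 0" "gap a b t0 = x 0" using gap_attains[OF ab x[of 0]] assms by auto
  obtain t where t: "t < 0" "gap a b t = x w" using gap_attains[OF ab x[of w]] assms by auto
  have uniq: "z = exp s" if "z > 0" "gap a b (ln z) = gap a b s" for z s
    using that strict_mono_eq[OF mono] by (metis exp_ln)
  have y: "y0L r \<mu> \<sigma> c lam L \<rho> = exp t0"
    unfolding y0L_def using t0 zeq uniq by (intro the_equality) (use t0 zeq uniq in \<open>simp, metis\<close>)
  have "x 0 < x w" using assms cr unfolding x_def by (intro divide_strict_right_mono) auto
  hence "t0 < t" using strict_mono_less[OF mono] t t0 by metis
  have z: "z_of_w r \<mu> \<sigma> c lam L \<rho> w = exp t"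
    unfolding z_of_w_def y
  proof (rule the_equality)
    show "exp t0 < exp t \<and> exp t < 1 \<and> z_equation r \<mu> \<sigma> c lam L \<rho> w (exp t)"
      using \<open>t0 < t\<close> t zeq by simp
  next
    fix z assume *: "exp t0 < z \<and> z < 1 \<and> z_equation r \<mu> \<sigma> c lam L \<rho> w z"
    hence "z > 0" using exp_gt_zero less_trans by blast
    thus "z = exp t" using * zeq t uniq by metis
  qed
  have B: "B3 r \<mu> \<sigma> lam \<rho> = a + 1" "B4 r \<mu> \<sigma> lam \<rho> = 1 - b" by (simp_all add: a_def b_def)
  have "opt_strategy r \<mu> \<sigma> c lam L \<rho> w = (\<mu> - r) / \<sigma>\<^sup>2 * (c / r + L) *
      (a * b / (a + b) * ((a + 1) * exp (a * t) - (1 - b) * exp (- b * t)))"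
    unfolding opt_strategy_def Let_def z B using assms(8,9)
    by (simp add: powr_def add.commute)
  also have "a * b / (a + b) * ((a + 1) * exp (a * t) - (1 - b) * exp (- b * t)) = alloc a b t"
    by (simp add: alloc_def left_diff_distrib)
  finally have "opt_strategy r \<mu> \<sigma> c lam L \<rho> w = (\<mu> - r) / \<sigma>\<^sup>2 * (c / r + L) * alloc a b t" .
  with t show ?thesis by (intro that[of t]) (auto simp: x_def)
qed

theorem proposition3p2:
  fixes r \<mu> \<sigma> c lam L \<rho>1 \<rho>2 :: real and \<pi>1 \<pi>2 :: "real \<Rightarrow> real"
  assumes "r > 0" and "\<mu> > r" and "\<sigma> > 0" and "c > 0" and "lam > 0" and "L > 0"
    and "0 < \<rho>1" and "\<rho>1 < \<rho>2"
    and "\<pi>1 = opt_strategy r \<mu> \<sigma> c lam L \<rho>1"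
    and "\<pi>2 = opt_strategy r \<mu> \<sigma> c lam L \<rho>2"
  shows "(\<forall>w. 0 < w \<and> w < c / r \<longrightarrow> \<pi>1 w = \<pi>2 w) \<and>
         (\<forall>w. - L < w \<and> w < 0 \<longrightarrow> \<pi>1 w < \<pi>2 w)"
proof (intro conjI allI impI)
  fix w assume "0 < w \<and> w < c / r"
  thus "\<pi>1 w = \<pi>2 w" by (simp add: assms(9,10) opt_strategy_def)
next
  fix w assume w: "- L < w \<and> w < 0"
  have "\<rho>2 > 0" using assms by simp
  define a1 b1 where "a1 = B3 r \<mu> \<sigma> lam \<rho>1 - 1" and "b1 = 1 - B4 r \<mu> \<sigma> lam \<rho>1"
  define a2 b2 where "a2 = B3 r \<mu> \<sigma> lam \<rho>2 - 1" and "b2 = 1 - B4 r \<mu> \<sigma> lam \<rho>2"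
  note ab1 = B3_B4[OF assms(1-3,5,7), folded a1_def b1_def]
  note ab2 = B3_B4[OF assms(1-3,5) \<open>\<rho>2 > 0\<close>, folded a2_def b2_def]
  obtain t1 where t1: "t1 < 0" "gap a1 b1 t1 = (c / r - w) / (c / r + L)"
      "\<pi>1 w = (\<mu> - r) / \<sigma>\<^sup>2 * (c / r + L) * alloc a1 b1 t1"
    using opt_strategy_below_zero[OF assms(1-7), of w] w unfolding a1_def b1_def assms(9) by blast
  obtain t2 where t2: "gap a2 b2 t2 = (c / r - w) / (c / r + L)"
      "\<pi>2 w = (\<mu> - r) / \<sigma>\<^sup>2 * (c / r + L) * alloc a2 b2 t2"
    using opt_strategy_below_zero[OF assms(1-6) \<open>\<rho>2 > 0\<close>, of w] w
    unfolding a2_def b2_def assms(10) by blast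
  have cr: "c / r > 0" "c / r + L > 0" using assms by (auto intro: add_pos_pos)
  have "alloc a1 b1 t1 < alloc a2 b2 t2"
  proof (rule alloc_less_alloc[OF ab1(1,2) ab2(1,2) _ _ t1(1)])
    show "a1 * b1 = a2 * b2" using ab1(3) ab2(3) by simp
    show "a2 - b2 < a1 - b1"
      unfolding ab1(4) ab2(4) using assms delta_pos by (simp add: divide_strict_right_mono)
    show "gap a1 b1 t1 > 0" unfolding t1 using w cr by (intro divide_pos_pos) auto
    show "gap a1 b1 t1 = gap a2 b2 t2" using t1 t2 by simp
  qed
  moreover have "(\<mu> - r) / \<sigma>\<^sup>2 * (c / r + L) > 0" using assms cr by simp
  ultimately show "\<pi>1 w < \<pi>2 w" unfolding t1 t2 by (simp only: mult_less_cancel_left_pos)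
qed

end
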